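(* Let $Y$ be a real Banach space and let $D\subset Y$ be a closed convex set. Then the following are equivalent: (i) the set $D$ has the Radon–Nikodým property; (ii) for every Banach space $X$ and every (nonempty) convex subset $C\subset X$, every $\mathcal{DC}$-bounded map $F\colon C\to D$ is dentable.
   Context: All Banach spaces are real. An open half-space of a Banach space $X$ is a set $\{x\in X: x^*(x)>a\}$ with $x^*\in X^*$, $a\in\mathbb R$. A map $f\colon C\to M$ from a nonempty subset $C$ of $X$ to a metric space $M$ is dentable if for every nonempty bounded $A\subset C$ and $\varepsilon>0$ there is an open half-space $H$ with $A\cap H\neq\emptyset$ and $\operatorname{diam}(f(A\cap H))<\varepsilon$. A closed convex set $D$ has the Radon–Nikodým property if and only if (Rieffel's characterisation, which may be taken as the definition) the identity map $D\to(D,\|\cdot\|)$ is dentable. A continuous map $F\colon C\to Y$ on a convex set $C\subset X$ is a $\mathcal{DC}$ map if there is a continuous function $f\colon C\to\mathbb R$ (called a control function for $F$) such that $f+y^*\circ F$ is a convex continuous function on $C$ for every $y^*$ in the unit sphere of $Y^*$. A $\mathcal{DC}$ map is $\mathcal{DC}$-bounded if it is bounded and admits a bounded control function. A $\mathcal{DC}$-bounded map $F\colon C\to D$ is a $\mathcal{DC}$-bounded map $C\to Y$ with values in $D$. *)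

theory Defs
  imports "HOL-Analysis.Analysis"
begin

text \<open>
  Quantification over all Banach spaces inside a formula is quantification over explicit
  carriers: a space is a record whose underlying set is an arbitrary subset of a type. Only the
  values of the operations on the underlying set matter.
\<close>

record 'a normed_data =
  points :: "'a set"
  vadd :: "'a \<Rightarrow> 'a \<Rightarrow> 'a"
  vzero :: "'a"
  smul :: "real \<Rightarrow> 'a \<Rightarrow> 'a"
  vnorm :: "'a \<Rightarrow> real"

text \<open>The value 0 off the underlying set is forced by the library's \<^locale>\<open>Metric_space\<close>, whose
  axioms of nonnegativity and symmetry are not relativised.\<close>

definition vdist :: "'a normed_data \<Rightarrow> 'a \<Rightarrow> 'a \<Rightarrow> real" where
  "vdist X x y =
     (if x \<in> points X \<and> y \<in> points X then vnorm X (vadd X x (smul X (-1) y)) else 0)"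

definition norm_topology :: "'a normed_data \<Rightarrow> 'a topology" where
  "norm_topology X = Metric_space.mtopology (points X) (vdist X)"

locale normed_space_on =
  fixes X :: "'a normed_data"
  assumes zero_closed: "vzero X \<in> points X"
    and add_closed: "\<lbrakk>x \<in> points X; y \<in> points X\<rbrakk> \<Longrightarrow> vadd X x y \<in> points X"
    and smul_closed: "x \<in> points X \<Longrightarrow> smul X a x \<in> points X"
    and add_assoc: "\<lbrakk>x \<in> points X; y \<in> points X; z \<in> points X\<rbrakk>
          \<Longrightarrow> vadd X (vadd X x y) z = vadd X x (vadd X y z)"
    and add_commute: "\<lbrakk>x \<in> points X; y \<in> points X\<rbrakk> \<Longrightarrow> vadd X x y = vadd X y x"
    and zero_add: "x \<in> points X \<Longrightarrow> vadd X (vzero X) x = x"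
    and add_minus: "x \<in> points X \<Longrightarrow> vadd X x (smul X (-1) x) = vzero X"
    and smul_add_right: "\<lbrakk>x \<in> points X; y \<in> points X\<rbrakk>
          \<Longrightarrow> smul X a (vadd X x y) = vadd X (smul X a x) (smul X a y)"
    and smul_add_left: "x \<in> points X \<Longrightarrow> smul X (a + b) x = vadd X (smul X a x) (smul X b x)"
    and smul_smul: "x \<in> points X \<Longrightarrow> smul X a (smul X b x) = smul X (a * b) x"
    and smul_one: "x \<in> points X \<Longrightarrow> smul X 1 x = x"
    and norm_eq_zero: "x \<in> points X \<Longrightarrow> vnorm X x = 0 \<longleftrightarrow> x = vzero X"
    and norm_triangle: "\<lbrakk>x \<in> points X; y \<in> points X\<rbrakk>
          \<Longrightarrow> vnorm X (vadd X x y) \<le> vnorm X x + vnorm X y"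
    and norm_smul: "x \<in> points X \<Longrightarrow> vnorm X (smul X a x) = \<bar>a\<bar> * vnorm X x"

locale banach_space_on = normed_space_on +
  assumes complete: "Metric_space.mcomplete (points X) (vdist X)"

definition dual_on :: "'a normed_data \<Rightarrow> ('a \<Rightarrow> real) set" where
  "dual_on X = {\<phi>.
     (\<forall>x\<in>points X. \<forall>y\<in>points X. \<phi> (vadd X x y) = \<phi> x + \<phi> y) \<and>
     (\<forall>a. \<forall>x\<in>points X. \<phi> (smul X a x) = a * \<phi> x) \<and>
     (\<exists>K. \<forall>x\<in>points X. \<bar>\<phi> x\<bar> \<le> K * vnorm X x)}"

definition open_half_space_on :: "'a normed_data \<Rightarrow> 'a set \<Rightarrow> bool" where
  "open_half_space_on X H \<longleftrightarrow> (\<exists>\<phi>\<in>dual_on X. \<exists>a. H = {x \<in> points X. \<phi> x > a})"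

definition bounded_on :: "'a normed_data \<Rightarrow> 'a set \<Rightarrow> bool" where
  "bounded_on X A \<longleftrightarrow> A \<subseteq> points X \<and> (\<exists>K. \<forall>x\<in>A. vnorm X x \<le> K)"

definition convex_set_on :: "'a normed_data \<Rightarrow> 'a set \<Rightarrow> bool" where
  "convex_set_on X C \<longleftrightarrow> C \<subseteq> points X \<and>
     (\<forall>x\<in>C. \<forall>y\<in>C. \<forall>t\<in>{0..1}. vadd X (smul X (1 - t) x) (smul X t y) \<in> C)"

definition convex_function_on :: "'a normed_data \<Rightarrow> 'a set \<Rightarrow> ('a \<Rightarrow> real) \<Rightarrow> bool" where
  "convex_function_on X C g \<longleftrightarrow>
     (\<forall>x\<in>C. \<forall>y\<in>C. \<forall>t\<in>{0..1}.
        g (vadd X (smul X (1 - t) x) (smul X t y)) \<le> (1 - t) * g x + t * g y)"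

definition continuous_function_on ::
    "'a normed_data \<Rightarrow> 'a set \<Rightarrow> ('a \<Rightarrow> 'm::topological_space) \<Rightarrow> bool" where
  "continuous_function_on X C g \<longleftrightarrow>
     continuous_map (subtopology (norm_topology X) C) euclidean g"

text \<open>\<^const>\<open>diameter\<close> is a real supremum and carries no information on unbounded sets, hence the
  separate boundedness condition.\<close>

definition dentable_on ::
    "'a normed_data \<Rightarrow> 'a set \<Rightarrow> ('a \<Rightarrow> 'm::metric_space) \<Rightarrow> bool" where
  "dentable_on X C f \<longleftrightarrow>
     (\<forall>A \<epsilon>. A \<noteq> {} \<and> A \<subseteq> C \<and> bounded_on X A \<and> \<epsilon> > 0 \<longrightarrow>
        (\<exists>H. open_half_space_on X H \<and> A \<inter> H \<noteq> {} \<and>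
             bounded (f ` (A \<inter> H)) \<and> diameter (f ` (A \<inter> H)) < \<epsilon>))"

definition control_function_on ::
    "'a normed_data \<Rightarrow> 'a set \<Rightarrow> ('a \<Rightarrow> 'y::real_normed_vector) \<Rightarrow> ('a \<Rightarrow> real) \<Rightarrow> bool" where
  "control_function_on X C F f \<longleftrightarrow>
     continuous_function_on X C f \<and>
     (\<forall>\<psi> :: 'y \<Rightarrow>\<^sub>L real. norm \<psi> = 1 \<longrightarrow>
        convex_function_on X C (\<lambda>x. f x + blinfun_apply \<psi> (F x)) \<and>
        continuous_function_on X C (\<lambda>x. f x + blinfun_apply \<psi> (F x)))"

definition DC_map_on ::
    "'a normed_data \<Rightarrow> 'a set \<Rightarrow> ('a \<Rightarrow> 'y::real_normed_vector) \<Rightarrow> bool" where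
  "DC_map_on X C F \<longleftrightarrow>
     continuous_function_on X C F \<and> (\<exists>f. control_function_on X C F f)"

definition DC_bounded_on ::
    "'a normed_data \<Rightarrow> 'a set \<Rightarrow> ('a \<Rightarrow> 'y::real_normed_vector) \<Rightarrow> bool" where
  "DC_bounded_on X C F \<longleftrightarrow>
     DC_map_on X C F \<and> bounded (F ` C) \<and>
     (\<exists>f. control_function_on X C F f \<and> bounded (f ` C))"

definition type_space :: "'y::real_normed_vector normed_data" where
  "type_space = \<lparr>points = UNIV, vadd = (+), vzero = 0, smul = (*\<^sub>R), vnorm = norm\<rparr>"

lemma vdist_type_space: "vdist type_space = dist"
  by (simp add: vdist_def type_space_def dist_norm fun_eq_iff)

lemma norm_topology_type_space: "norm_topology type_space = euclidean"
  by (simp add: norm_topology_def vdist_type_space) (simp add: type_space_def)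

lemma dual_on_type_space: "dual_on type_space = {\<phi>. bounded_linear \<phi>}"
proof -
  have "\<phi> \<in> dual_on type_space \<longleftrightarrow> bounded_linear \<phi>" for \<phi> :: "'a \<Rightarrow> real"
    unfolding dual_on_def type_space_def bounded_linear_def bounded_linear_axioms_def linear_iff
    by (auto simp: mult.commute)
  then show ?thesis by auto
qed

lemma bounded_on_type_space: "bounded_on type_space A \<longleftrightarrow> bounded A"
  by (simp add: bounded_on_def type_space_def bounded_iff)

lemma banach_space_on_type_space: "banach_space_on (type_space :: 'y::banach normed_data)"
proof
  have "Met_TC.mcomplete TYPE('y)"
    unfolding Met_TC.mcomplete_def
    by (auto simp: Met_TC.MCauchy_def Cauchy_def intro!: Cauchy_convergent
        simp flip: convergent_def)
  then show "Metric_space.mcomplete (points (type_space :: 'y normed_data)) (vdist type_space)"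
    by (simp add: vdist_type_space) (simp add: type_space_def)
qed (auto simp: type_space_def algebra_simps norm_triangle_ineq)

text \<open>Rieffel's characterisation, taken as the definition. The diameter of a subset of \<open>D\<close> is the
  same in \<open>D\<close> and in the whole space. The empty set has the property.\<close>

definition radon_nikodym_property :: "'y::banach set \<Rightarrow> bool" where
  "radon_nikodym_property D \<longleftrightarrow> dentable_on type_space D (\<lambda>y. y)"

text \<open>
  The theorem quantifies over the Banach spaces whose underlying set is a subset of \<open>'y + 'u\<close>,
  where \<open>'y\<close> is the ambient type of \<open>D\<close> and \<open>'u\<close> is an arbitrary type. Since a Banach space with
  points in a type \<open>'u\<close> has an isometric copy along \<^const>\<open>Inr\<close>, and \<open>'u\<close> is universally
  quantified, every Banach space is covered; an arbitrary type \<open>'u\<close> alone would not do, because it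
  may be so small that the only Banach space on its subsets is the zero space.
\<close>

end

theory Submission
  imports Defs
begin

text \<open>
  The substantial direction is a form of Stegall's variational principle. Let \<open>f\<close> be a bounded
  control function of \<open>F\<close> and \<open>A\<close> a bounded subset of \<open>C\<close>. Suppose that for every functional \<open>\<psi>\<close> with
  \<open>norm \<psi> \<le> 1\<close> all sets of near-maximisers of \<open>f + \<psi> \<circ> F\<close> on \<open>A\<close> have \<open>F\<close>-images of diameter at least
  \<open>\<epsilon>\<close>. Perturbing \<open>\<psi>\<close> by a separating functional then shows that the value of \<open>F\<close> at each
  near-maximiser is almost a convex combination of values, at near-maximisers for nearby functionals,
  that are \<open>\<epsilon> / 3\<close> away from it. This yields an approximate bush in \<open>D\<close>, which can be corrected to an
  exact one, and a bush is not dentable. So some superlevel set of \<open>f + \<psi> \<circ> F\<close> on \<open>A\<close> has a small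
  image under \<open>F\<close>; as \<open>f + \<psi> \<circ> F\<close> is convex and continuous, the Hahn-Banach theorem puts a nonempty
  slice of \<open>A\<close> inside it.

  Conversely, the identity on a bounded convex subset of \<open>D\<close> has the control function \<open>0\<close>.
\<close>

subsection \<open>The Hahn-Banach theorem on carriers\<close>

text \<open>An inequality for positive scalars passes easily to infima; applied to \<open>a\<close>
  and \<open>1 / a\<close> it yields equality, and doubling the zero vector gives the value 0
  there.\<close>

definition sublinear_on :: "'a normed_data \<Rightarrow> ('a \<Rightarrow> real) \<Rightarrow> bool" where
  "sublinear_on X q \<longleftrightarrow>
     (\<forall>x\<in>points X. \<forall>y\<in>points X. q (vadd X x y) \<le> q x + q y) \<and>
     (\<forall>a>0. \<forall>x\<in>points X. q (smul X a x) \<le> a * q x)"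

context normed_space_on
begin

section \<open>Vector arithmetic and the metric of a carrier\<close>

abbreviation minus_vec :: "'a \<Rightarrow> 'a" where
  "minus_vec \<equiv> smul X (-1)"

lemma smul_0_left: "x \<in> points X \<Longrightarrow> smul X 0 x = vzero X"
  by (metis norm_eq_zero norm_smul smul_closed abs_zero mult_zero_left)

lemma smul_zero: "smul X a (vzero X) = vzero X"
  by (metis norm_eq_zero norm_smul smul_closed zero_closed mult_zero_right)

lemma add_zero: "x \<in> points X \<Longrightarrow> vadd X x (vzero X) = x"
  by (metis add_commute zero_add zero_closed)

lemma add_exchange:
  assumes "x \<in> points X" "y \<in> points X" "u \<in> points X" "v \<in> points X"
  shows "vadd X (vadd X x u) (vadd X y v) = vadd X (vadd X x y) (vadd X u v)"
  using assms by (smt (verit) add_assoc add_closed add_commute)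

lemma minus_vec_minus_vec: "x \<in> points X \<Longrightarrow> minus_vec (minus_vec x) = x"
  by (simp add: smul_smul smul_one)

lemma minus_vec_add: "x \<in> points X \<Longrightarrow> vadd X (minus_vec x) x = vzero X"
  by (simp add: add_commute add_minus smul_closed)

lemma norm_minus: "x \<in> points X \<Longrightarrow> vnorm X (minus_vec x) = vnorm X x"
  by (simp add: norm_smul)

lemma norm_nonneg: "x \<in> points X \<Longrightarrow> 0 \<le> vnorm X x"
  using norm_triangle[of x "minus_vec x"]
    norm_eq_zero[OF zero_closed]
  by (simp add: smul_closed add_minus norm_minus)

lemma minus_vec_diff:
  assumes "x \<in> points X" "y \<in> points X"
  shows "minus_vec (vadd X x (minus_vec y)) = vadd X y (minus_vec x)"
  using assms by (simp add: smul_add_right smul_closed minus_vec_minus_vec add_commute)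

lemma vdist_commute: "vdist X x y = vdist X y x"
proof (cases "x \<in> points X \<and> y \<in> points X")
  case True
  then show ?thesis
    using norm_minus[of "vadd X x (minus_vec y)"]
    by (simp add: vdist_def minus_vec_diff add_closed smul_closed)
qed (auto simp: vdist_def)

lemma diff_eq_zero_iff:
  assumes "x \<in> points X" "y \<in> points X"
  shows "vadd X x (minus_vec y) = vzero X \<longleftrightarrow> x = y"
proof
  assume "vadd X x (minus_vec y) = vzero X"
  then have "vadd X (vadd X x (minus_vec y)) y = y"
    using assms by (simp add: zero_add)
  then show "x = y"
    using assms by (simp add: add_assoc smul_closed minus_vec_add add_zero)
qed (use assms add_minus in auto)

lemma diff_add_diff:
  assumes "x \<in> points X" "y \<in> points X" "z \<in> points X"
  shows "vadd X (vadd X x (minus_vec y)) (vadd X y (minus_vec z)) = vadd X x (minus_vec z)"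
proof -
  have "vadd X (vadd X x (minus_vec y)) (vadd X y (minus_vec z))
      = vadd X x (vadd X (vadd X (minus_vec y) y) (minus_vec z))"
    using assms by (simp add: add_assoc add_closed smul_closed)
  then show ?thesis
    using assms by (simp add: minus_vec_add zero_add smul_closed)
qed

lemma Metric_space_vdist: "Metric_space (points X) (vdist X)"
proof
  show "0 \<le> vdist X x y" for x y
    by (simp add: vdist_def norm_nonneg add_closed smul_closed)
  show "vdist X x y = vdist X y x" for x y
    by (rule vdist_commute)
  show "vdist X x y = 0 \<longleftrightarrow> x = y" if "x \<in> points X" "y \<in> points X" for x y
    using that by (simp add: vdist_def norm_eq_zero diff_eq_zero_iff add_closed smul_closed)
  show "vdist X x z \<le> vdist X x y + vdist X y z"
    if "x \<in> points X" "y \<in> points X" "z \<in> points X" for x y z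
    using that norm_triangle[of "vadd X x (minus_vec y)" "vadd X y (minus_vec z)"]
    by (simp add: vdist_def diff_add_diff add_closed smul_closed)
qed

section \<open>Sublinear functionals and minimal ones\<close>

lemma sublinear_scale:
  assumes "sublinear_on X q" "a > 0" "x \<in> points X"
  shows "q (smul X a x) = a * q x"
proof (rule antisym)
  show "q (smul X a x) \<le> a * q x"
    using assms by (simp add: sublinear_on_def)
  have "q (smul X (1 / a) (smul X a x)) \<le> 1 / a * q (smul X a x)"
    using assms smul_closed[of x a] unfolding sublinear_on_def by (metis zero_less_divide_1_iff)
  then show "a * q x \<le> q (smul X a x)"
    using assms by (simp add: smul_smul smul_one field_simps)
qed

lemma sublinear_zero: "sublinear_on X q \<Longrightarrow> q (vzero X) = 0"
  using sublinear_scale[of q 2 "vzero X"] by (simp add: smul_zero zero_closed)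

lemma sublinear_minus: "\<lbrakk>sublinear_on X q; x \<in> points X\<rbrakk> \<Longrightarrow> - q (minus_vec x) \<le> q x"
proof -
  assume q: "sublinear_on X q" and x: "x \<in> points X"
  have "q (vadd X x (minus_vec x)) \<le> q x + q (minus_vec x)"
    using q x by (simp add: sublinear_on_def smul_closed)
  then show ?thesis
    using x by (simp add: add_minus sublinear_zero[OF q])
qed

text \<open>The functional \<open>p\<close> is the infimal convolution of \<open>q\<close> with the values prescribed on the cone.\<close>

lemma sublinear_below:
  assumes q: "sublinear_on X q"
    and G: "G \<subseteq> points X \<times> UNIV" "(vzero X, 0) \<in> G"
    and G_add: "\<And>k s l t. \<lbrakk>(k, s) \<in> G; (l, t) \<in> G\<rbrakk> \<Longrightarrow> (vadd X k l, s + t) \<in> G"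
    and G_smul: "\<And>a k s. \<lbrakk>a > 0; (k, s) \<in> G\<rbrakk> \<Longrightarrow> (smul X a k, a * s) \<in> G"
    and G_le: "\<And>k s. (k, s) \<in> G \<Longrightarrow> s \<le> q k"
  obtains p where "sublinear_on X p" "\<And>x. x \<in> points X \<Longrightarrow> p x \<le> q x"
    "\<And>k s. (k, s) \<in> G \<Longrightarrow> p (minus_vec k) \<le> - s"
proof
  define p where "p x = (INF g\<in>G. q (vadd X x (fst g)) - snd g)" for x
  \<comment> \<open>Writing \<open>k\<close> as \<open>- x + (x + k)\<close> gives a bound
    independent of \<open>(k, s)\<close>, so the infimum is finite.\<close>
  have lower: "- q (minus_vec x) \<le> q (vadd X x k) - s" if "x \<in> points X" "(k, s) \<in> G" for x k s
  proof -
    have k: "k \<in> points X"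
      using that G by auto
    have "vadd X (minus_vec x) (vadd X x k) = k"
      using that k by (metis add_assoc minus_vec_add smul_closed zero_add)
    then have "q k \<le> q (minus_vec x) + q (vadd X x k)"
      using q that k unfolding sublinear_on_def by (metis add_closed smul_closed)
    then show ?thesis
      using G_le[OF that(2)] by linarith
  qed
  then have bdd: "bdd_below ((\<lambda>g. q (vadd X x (fst g)) - snd g) ` G)" if "x \<in> points X" for x
    using that unfolding bdd_below_def by force
  have p_le: "p x \<le> q (vadd X x k) - s" if "x \<in> points X" "(k, s) \<in> G" for x k s
    unfolding p_def using cINF_lower[OF bdd[OF that(1)] that(2)] by simp
  have p_ge: "c \<le> p x" if "\<And>k s. (k, s) \<in> G \<Longrightarrow> c \<le> q (vadd X x k) - s" for x c
    unfolding p_def using G(2) that by (intro cINF_greatest) auto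
  show "p x \<le> q x" if "x \<in> points X" for x
    using p_le[OF that G(2)] that by (simp add: add_zero)
  show "p (minus_vec k) \<le> - s" if "(k, s) \<in> G" for k s
  proof -
    have k: "k \<in> points X"
      using that G by auto
    show ?thesis
      using p_le[OF smul_closed[OF k] that, of "-1"] by (simp add: minus_vec_add k sublinear_zero[OF q])
  qed
  show "sublinear_on X p"
    unfolding sublinear_on_def
  proof (intro conjI ballI allI impI)
    fix x y assume x: "x \<in> points X" and y: "y \<in> points X"
    \<comment> \<open>The two infima in \<open>p x + p y\<close> are taken one after the other:
      \<open>(l, t)\<close> stays fixed while \<open>(k, s)\<close> varies.\<close>
    have "p (vadd X x y) - (q (vadd X y l) - t) \<le> p x" if l: "(l, t) \<in> G" for l t
    proof (rule p_ge)
      fix k s assume k: "(k, s) \<in> G"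
      have pts: "k \<in> points X" "l \<in> points X"
        using k l G by auto
      have "p (vadd X x y) \<le> q (vadd X (vadd X x y) (vadd X k l)) - (s + t)"
        by (rule p_le) (use x y G_add[OF k l] add_closed in auto)
      also have "vadd X (vadd X x y) (vadd X k l) = vadd X (vadd X x k) (vadd X y l)"
        using x y pts by (simp add: add_exchange)
      also have "q \<dots> \<le> q (vadd X x k) + q (vadd X y l)"
        using q x y pts by (simp add: sublinear_on_def add_closed)
      finally show "p (vadd X x y) - (q (vadd X y l) - t) \<le> q (vadd X x k) - s"
        by linarith
    qed
    then have "p (vadd X x y) - p x \<le> p y"
      by (intro p_ge) (simp add: algebra_simps)
    then show "p (vadd X x y) \<le> p x + p y"
      by linarith
  next
    fix a :: real and x assume a: "a > 0" and x: "x \<in> points X"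
    have "p (smul X a x) / a \<le> p x"
    proof (rule p_ge)
      fix k s assume k: "(k, s) \<in> G"
      have pts: "k \<in> points X"
        using k G by auto
      have "p (smul X a x) \<le> q (vadd X (smul X a x) (smul X a k)) - a * s"
        by (rule p_le) (use x smul_closed G_smul[OF a k] in auto)
      also have "vadd X (smul X a x) (smul X a k) = smul X a (vadd X x k)"
        using x pts by (simp add: smul_add_right)
      also have "q \<dots> = a * q (vadd X x k)"
        using q a x pts by (simp add: sublinear_scale add_closed)
      finally show "p (smul X a x) / a \<le> q (vadd X x k) - s"
        using a by (simp add: field_simps)
    qed
    then show "p (smul X a x) \<le> a * p x"
      using a by (simp add: field_simps)
  qed
qed

text \<open>Zorn's lemma. A chain is bounded by its pointwise infimum, which is finite because every
  \<open>q\<close> below \<open>p\<close> satisfies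
  \<open>q x \<ge> - q (- x) \<ge> - p (- x)\<close>.\<close>

lemma minimal_sublinear_exists:
  assumes p: "sublinear_on X p"
  obtains q where "sublinear_on X q" "\<And>x. x \<in> points X \<Longrightarrow> q x \<le> p x"
    "\<And>r. \<lbrakk>sublinear_on X r; \<And>x. x \<in> points X \<Longrightarrow> r x \<le> q x\<rbrakk> \<Longrightarrow> \<forall>x\<in>points X. r x = q x"
proof -
  \<comment> \<open>The value 0 off the carrier makes comparison on \<open>points X\<close>
    antisymmetric.\<close>
  define S where "S = {q. sublinear_on X q \<and> (\<forall>x\<in>points X. q x \<le> p x) \<and> (\<forall>x. x \<notin> points X \<longrightarrow> q x = 0)}"
  \<comment> \<open>The order is reversed, so that a maximal element is a minimal
    functional.\<close>
  define below where "below q r \<longleftrightarrow> (\<forall>x\<in>points X. r x \<le> q x)" for q r :: "'a \<Rightarrow> real"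
  define cut where "cut q x = (if x \<in> points X then q x else 0)" for q :: "'a \<Rightarrow> real" and x
  have cut: "sublinear_on X (cut q)" if "sublinear_on X q" for q
    using that by (simp add: sublinear_on_def cut_def add_closed smul_closed)
  have "\<exists>m\<in>S. \<forall>q\<in>S. below m q \<longrightarrow> q = m"
  proof (rule predicate_Zorn)
    show "partial_order_on S (relation_of below S)"
      by (rule partial_order_on_relation_ofI) (auto simp: below_def S_def fun_eq_iff intro: order_trans antisym, metis antisym)
  next
    fix C assume C: "C \<in> Chains (relation_of below S)"
    have CS: "q \<in> S" if "q \<in> C" for q
      using C that by (auto simp: Chains_def relation_of_def)
    have tot: "below q r \<or> below r q" if "q \<in> C" "r \<in> C" for q r
      using C that by (auto simp: Chains_def relation_of_def)
    show "\<exists>u\<in>S. \<forall>q\<in>C. below q u"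
    proof (cases "C = {}")
      case True
      moreover have "cut p \<in> S"
        using cut[OF p] by (simp add: S_def cut_def)
      ultimately show ?thesis by auto
    next
      case False
      define u where "u x = (if x \<in> points X then INF q\<in>C. q x else 0)" for x
      have bdd: "bdd_below ((\<lambda>q. q x) ` C)" if x: "x \<in> points X" for x
      proof (rule bdd_belowI2)
        fix q assume "q \<in> C"
        then have "sublinear_on X q" "q (minus_vec x) \<le> p (minus_vec x)"
          using CS x by (auto simp: S_def smul_closed)
        then show "- p (minus_vec x) \<le> q x"
          using sublinear_minus[of q x] x by linarith
      qed
      have u_le: "u x \<le> q x" if "x \<in> points X" "q \<in> C" for x q
        using cINF_lower[OF bdd[OF that(1)] that(2)] that by (simp add: u_def)
      have u_ge: "c \<le> u x" if "x \<in> points X" "\<And>q. q \<in> C \<Longrightarrow> c \<le> q x" for c x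
        using that False by (auto simp: u_def intro: cINF_greatest)
      have "sublinear_on X u"
        unfolding sublinear_on_def
      proof (intro conjI ballI allI impI)
        fix x y assume x: "x \<in> points X" and y: "y \<in> points X"
        have "u (vadd X x y) - r y \<le> u x" if r: "r \<in> C" for r
        proof (rule u_ge[OF x])
          fix q assume q: "q \<in> C"
          have sub: "s (vadd X x y) \<le> s x + s y" if "s \<in> C" for s
            using CS[OF that] x y by (simp add: S_def sublinear_on_def)
          \<comment> \<open>Members of a chain are comparable: subadditivity of the smaller of
            \<open>q\<close> and \<open>r\<close> bounds \<open>u\<close> at the sum by
            \<open>q x + r y\<close>.\<close>
          show "u (vadd X x y) - r y \<le> q x"
            using tot[OF q r] sub[OF q] sub[OF r] u_le[OF _ q, of "vadd X x y"]
              u_le[OF _ r, of "vadd X x y"] x y add_closed[OF x y]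
            unfolding below_def by force
        qed
        then have "u (vadd X x y) - u x \<le> u y"
          by (intro u_ge[OF y]) (simp add: algebra_simps)
        then show "u (vadd X x y) \<le> u x + u y"
          by linarith
      next
        fix a :: real and x assume a: "a > 0" and x: "x \<in> points X"
        have "u (smul X a x) / a \<le> u x"
        proof (rule u_ge[OF x])
          fix q assume q: "q \<in> C"
          then have "q (smul X a x) \<le> a * q x"
            using CS a x by (auto simp: S_def sublinear_on_def)
          then have "u (smul X a x) \<le> a * q x"
            using u_le[OF smul_closed[OF x] q, of a] by linarith
          then show "u (smul X a x) / a \<le> q x"
            using a by (simp add: field_simps)
        qed
        then show "u (smul X a x) \<le> a * u x"
          using a by (simp add: field_simps)
      qed
      moreover have "u x \<le> p x" if x: "x \<in> points X" for x
      proof -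
        obtain q where "q \<in> C" using False by auto
        then show ?thesis
          using u_le[OF x] CS x unfolding S_def by force
      qed
      moreover have "u x = 0" if "x \<notin> points X" for x
        using that by (simp add: u_def)
      ultimately have "u \<in> S"
        by (simp add: S_def)
      then show ?thesis
        using u_le by (auto simp: below_def)
    qed
  qed
  then obtain q where q: "q \<in> S" and min: "\<And>r. r \<in> S \<Longrightarrow> below q r \<Longrightarrow> r = q"
    by auto
  show ?thesis
  proof
    show "sublinear_on X q" and le: "\<And>x. x \<in> points X \<Longrightarrow> q x \<le> p x"
      using q by (auto simp: S_def)
    fix r assume r: "sublinear_on X r" "\<And>x. x \<in> points X \<Longrightarrow> r x \<le> q x"
    have "cut r = q"
    proof (rule min)
      show "cut r \<in> S"
        using cut[OF r(1)] r(2) le by (force simp: S_def cut_def)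
      show "below q (cut r)"
        using r(2) by (simp add: below_def cut_def)
    qed
    then show "\<forall>x\<in>points X. r x = q x"
      by (metis cut_def)
  qed
qed

text \<open>A minimal sublinear functional below \<open>p\<close> is linear: lowering it along a ray
  cannot change it, and this forces it to be odd.\<close>

lemma Hahn_Banach_sublinear:
  assumes p: "sublinear_on X p"
  obtains \<phi> where "\<And>x. x \<in> points X \<Longrightarrow> \<phi> x \<le> p x"
    "\<And>x y. \<lbrakk>x \<in> points X; y \<in> points X\<rbrakk> \<Longrightarrow> \<phi> (vadd X x y) = \<phi> x + \<phi> y"
    "\<And>a x. x \<in> points X \<Longrightarrow> \<phi> (smul X a x) = a * \<phi> x"
proof -
  obtain q where q: "sublinear_on X q" and le: "\<And>x. x \<in> points X \<Longrightarrow> q x \<le> p x"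
    and min: "\<And>r. \<lbrakk>sublinear_on X r; \<And>x. x \<in> points X \<Longrightarrow> r x \<le> q x\<rbrakk> \<Longrightarrow> \<forall>x\<in>points X. r x = q x"
    using minimal_sublinear_exists[OF p] by blast
  \<comment> \<open>a sublinear functional is linear as soon as it is odd\<close>
  have minus: "q (minus_vec y) = - q y" if y: "y \<in> points X" for y
  proof -
    \<comment> \<open>The ray through \<open>y\<close> carrying the values of \<open>q\<close>. The
      lowered functional \<open>r\<close> equals \<open>q\<close> by minimality, so
      \<open>q (- y) \<le> - q y\<close>.\<close>
    define G where "G = {(smul X t y, t * q y) |t. t \<ge> 0}"
    obtain r where r: "sublinear_on X r" "\<And>x. x \<in> points X \<Longrightarrow> r x \<le> q x"
      and rG: "\<And>k s. (k, s) \<in> G \<Longrightarrow> r (minus_vec k) \<le> - s"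
    proof (rule sublinear_below[OF q, of G])
      show "G \<subseteq> points X \<times> UNIV"
        using y by (auto simp: G_def smul_closed)
      show "(vzero X, 0) \<in> G"
        using y by (auto simp: G_def smul_0_left intro!: exI[of _ 0])
      show "(vadd X k l, s + t) \<in> G" if "(k, s) \<in> G" "(l, t) \<in> G" for k s l t
      proof -
        obtain a b where "a \<ge> 0" "b \<ge> 0"
          and eqs: "k = smul X a y" "s = a * q y" "l = smul X b y" "t = b * q y"
          using \<open>(k, s) \<in> G\<close> \<open>(l, t) \<in> G\<close> unfolding G_def by blast
        then have "vadd X k l = smul X (a + b) y" "s + t = (a + b) * q y" "a + b \<ge> 0"
          using y by (auto simp: smul_add_left distrib_right)
        then show ?thesis
          unfolding G_def by blast
      qed
      show "(smul X a k, a * s) \<in> G" if a: "a > 0" and k: "(k, s) \<in> G" for a k s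
      proof -
        obtain t where t: "t \<ge> 0" and eqs: "k = smul X t y" "s = t * q y"
          using k unfolding G_def by blast
        have "smul X a k = smul X (a * t) y" "a * s = (a * t) * q y" "a * t \<ge> 0"
          using a t y by (auto simp: eqs smul_smul)
        then show ?thesis
          unfolding G_def by blast
      qed
      show "s \<le> q k" if "(k, s) \<in> G" for k s
        using that y sublinear_zero[OF q]
        by (auto simp: G_def le_less sublinear_scale[OF q] smul_0_left)
    qed blast
    have "(y, q y) \<in> G"
      using y by (auto simp: G_def smul_one intro!: exI[of _ 1])
    then have "q (minus_vec y) \<le> - q y"
      using rG min[OF r] y smul_closed by force
    then show ?thesis
      using sublinear_minus[OF q y] by linarith
  qed
  have sub: "q (vadd X x y) \<le> q x + q y" if "x \<in> points X" "y \<in> points X" for x y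
    using q that by (simp add: sublinear_on_def)
  show ?thesis
  proof
    show "\<And>x. x \<in> points X \<Longrightarrow> q x \<le> p x"
      by (rule le)
    show "q (vadd X x y) = q x + q y" if x: "x \<in> points X" and y: "y \<in> points X" for x y
      using sub[OF x y] sub[OF smul_closed[OF x] smul_closed[OF y], of "-1" "-1"]
        minus[OF x] minus[OF y] minus[OF add_closed[OF x y]] smul_add_right[OF x y, of "-1"]
      by simp
    show "q (smul X a x) = a * q x" if x: "x \<in> points X" for a x
    proof -
      consider "a > 0" | "a = 0" | "a < 0" by linarith
      then show ?thesis
      proof cases
        case 3
        have "smul X a x = minus_vec (smul X (- a) x)"
          using x by (simp add: smul_smul)
        then show ?thesis
          using 3 x minus[OF smul_closed[OF x, of "- a"]] sublinear_scale[OF q, of "- a" x] by simp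
      qed (use x in \<open>auto simp: sublinear_scale[OF q] smul_0_left sublinear_zero[OF q]\<close>)
    qed
  qed
qed

section \<open>Separation of convex sets from points\<close>

lemma separation_from_zero:
  assumes K: "convex_set_on X K" and r: "\<And>k. k \<in> K \<Longrightarrow> r \<le> vnorm X k"
  obtains \<phi> where "\<phi> \<in> dual_on X" "\<And>x. x \<in> points X \<Longrightarrow> \<bar>\<phi> x\<bar> \<le> vnorm X x"
    "\<And>k. k \<in> K \<Longrightarrow> r \<le> \<phi> k"
proof -
  have KX: "k \<in> points X" if "k \<in> K" for k
    using K that by (auto simp: convex_set_on_def)
  \<comment> \<open>The cone generated by \<open>K\<close>, with value \<open>r\<close> prescribed
    on \<open>K\<close>; these values lie below the norm by the assumption on \<open>r\<close>. The
    vertex is added by hand, since \<open>K\<close> may be empty and the multiples are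
    positive.\<close>
  define G where "G = insert (vzero X, 0) {(smul X t k, t * r) |t k. t > 0 \<and> k \<in> K}"
  have add: "(vadd X (smul X s k) (smul X t l), s * r + t * r) \<in> G"
    if "s > 0" "t > 0" "k \<in> K" "l \<in> K" for s t k l
  proof -
    \<comment> \<open>Convexity enters here: a sum of positive multiples of points of
      \<open>K\<close> is \<open>s + t\<close> times a point of \<open>K\<close>.\<close>
    define m where "m = vadd X (smul X (1 - t / (s + t)) k) (smul X (t / (s + t)) l)"
    have "t / (s + t) \<in> {0..1}"
      using that by simp
    then have "m \<in> K"
      using K that unfolding convex_set_on_def m_def by blast
    moreover have "smul X (s + t) m = vadd X (smul X s k) (smul X t l)"
    proof -
      have "(s + t) * (1 - t / (s + t)) = s" "(s + t) * (t / (s + t)) = t"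
        using that by (auto simp: field_simps)
      then show ?thesis
        using that KX by (simp add: m_def smul_add_right smul_closed smul_smul)
    qed
    ultimately have "(smul X (s + t) m, (s + t) * r) \<in> G"
      using that unfolding G_def by (auto intro!: exI[of _ "s + t"] exI[of _ m])
    then show ?thesis
      using \<open>smul X (s + t) m = _\<close> by (simp add: distrib_right)
  qed
  have "sublinear_on X (vnorm X)"
    by (simp add: sublinear_on_def norm_triangle norm_smul)
  then obtain p where p: "sublinear_on X p" "\<And>x. x \<in> points X \<Longrightarrow> p x \<le> vnorm X x"
    and pG: "\<And>k s. (k, s) \<in> G \<Longrightarrow> p (minus_vec k) \<le> - s"
  proof (rule sublinear_below[where G = G])
    show "G \<subseteq> points X \<times> UNIV"
      using KX by (auto simp: G_def smul_closed zero_closed)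
    show "(vzero X, 0) \<in> G"
      by (simp add: G_def)
    show "(vadd X k l, s + t) \<in> G" if k: "(k, s) \<in> G" and l: "(l, t) \<in> G" for k s l t
    proof -
      have pts: "k \<in> points X" "l \<in> points X"
        using k l KX by (auto simp: G_def smul_closed zero_closed)
      show ?thesis
      proof (cases "(k, s) = (vzero X, 0) \<or> (l, t) = (vzero X, 0)")
        case True
        then show ?thesis
          using k l pts by (auto simp: zero_add add_zero)
      next
        case False
        then show ?thesis
          using k l add unfolding G_def by blast
      qed
    qed
    show "(smul X a k, a * s) \<in> G" if a: "a > 0" and k: "(k, s) \<in> G" for a k s
    proof (cases "(k, s) = (vzero X, 0)")
      case True
      then show ?thesis by (simp add: G_def smul_zero)
    next
      case False
      then obtain t l where "t > 0" "l \<in> K" "k = smul X t l" "s = t * r"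
        using k unfolding G_def by blast
      then show ?thesis
        using a KX by (auto simp: G_def smul_smul intro!: exI[of _ "a * t"] exI[of _ l])
    qed
    show "s \<le> vnorm X k" if "(k, s) \<in> G" for k s
      using that r KX norm_eq_zero[OF zero_closed]
      by (auto simp: G_def norm_smul)
  qed blast
  obtain \<phi> where le: "\<And>x. x \<in> points X \<Longrightarrow> \<phi> x \<le> p x"
    and \<phi>_add: "\<And>x y. \<lbrakk>x \<in> points X; y \<in> points X\<rbrakk> \<Longrightarrow> \<phi> (vadd X x y) = \<phi> x + \<phi> y"
    and \<phi>_smul: "\<And>a x. x \<in> points X \<Longrightarrow> \<phi> (smul X a x) = a * \<phi> x"
    using Hahn_Banach_sublinear[OF p(1)] by blast
  have bound: "\<bar>\<phi> x\<bar> \<le> vnorm X x" if x: "x \<in> points X" for x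
    using le[OF x] p(2)[OF x] le[OF smul_closed[OF x], of "-1"] p(2)[OF smul_closed[OF x], of "-1"]
      \<phi>_smul[OF x, of "-1"] norm_minus[OF x] by linarith
  show ?thesis
  proof
    show "\<phi> \<in> dual_on X"
      unfolding dual_on_def using \<phi>_add \<phi>_smul bound by (auto intro!: exI[of _ 1])
    show "\<bar>\<phi> x\<bar> \<le> vnorm X x" if "x \<in> points X" for x
      using bound[OF that] .
    show "r \<le> \<phi> k" if k: "k \<in> K" for k
    proof -
      have "(k, r) \<in> G"
        using k KX by (auto simp: G_def smul_one intro!: exI[of _ 1] exI[of _ k])
      then show ?thesis
        using pG[of k r] le[OF smul_closed[OF KX[OF k]], of "-1"] \<phi>_smul[OF KX[OF k], of "-1"]
        by linarith
    qed
  qed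
qed

text \<open>This is \<open>separation_from_zero\<close> for the convex set of differences
  \<open>x - c\<close>.\<close>

lemma separation_from_point:
  assumes C: "convex_set_on X C" and x: "x \<in> points X"
    and r: "\<And>c. c \<in> C \<Longrightarrow> r \<le> vdist X x c"
  obtains \<phi> where "\<phi> \<in> dual_on X" "\<And>y. y \<in> points X \<Longrightarrow> \<bar>\<phi> y\<bar> \<le> vnorm X y"
    "\<And>c. c \<in> C \<Longrightarrow> \<phi> c + r \<le> \<phi> x"
proof -
  define K where "K = (\<lambda>c. vadd X x (minus_vec c)) ` C"
  have CX: "c \<in> points X" if "c \<in> C" for c
    using C that by (auto simp: convex_set_on_def)
  have "convex_set_on X K"
    unfolding convex_set_on_def
  proof (intro conjI ballI)
    show "K \<subseteq> points X"
      using x CX by (auto simp: K_def add_closed smul_closed)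
    fix k l and t :: real assume "k \<in> K" "l \<in> K" and t: "t \<in> {0..1}"
    then obtain c d where c: "c \<in> C" "k = vadd X x (minus_vec c)"
      and d: "d \<in> C" "l = vadd X x (minus_vec d)"
      by (auto simp: K_def)
    define e where "e = vadd X (smul X (1 - t) c) (smul X t d)"
    have "e \<in> C"
      using C c d t by (auto simp: convex_set_on_def e_def)
    moreover have "vadd X (smul X (1 - t) k) (smul X t l) = vadd X x (minus_vec e)"
    proof -
      have "vadd X (smul X (1 - t) k) (smul X t l)
          = vadd X (vadd X (smul X (1 - t) x) (smul X t x))
              (vadd X (smul X (1 - t) (minus_vec c)) (smul X t (minus_vec d)))"
        using c d x CX by (simp add: smul_add_right smul_closed add_exchange)
      also have "vadd X (smul X (1 - t) x) (smul X t x) = x"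
        using x by (simp add: smul_add_left[symmetric] smul_one)
      also have "vadd X (smul X (1 - t) (minus_vec c)) (smul X t (minus_vec d)) = minus_vec e"
        using c d CX by (simp add: e_def smul_add_right smul_closed smul_smul)
      finally show ?thesis .
    qed
    ultimately show "vadd X (smul X (1 - t) k) (smul X t l) \<in> K"
      by (auto simp: K_def)
  qed
  moreover have "r \<le> vnorm X k" if "k \<in> K" for k
    using that r x CX by (force simp: K_def vdist_def)
  ultimately obtain \<phi> where \<phi>: "\<phi> \<in> dual_on X" "\<And>y. y \<in> points X \<Longrightarrow> \<bar>\<phi> y\<bar> \<le> vnorm X y"
    "\<And>k. k \<in> K \<Longrightarrow> r \<le> \<phi> k"
    using separation_from_zero by metis
  have "\<phi> c + r \<le> \<phi> x" if c: "c \<in> C" for c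
  proof -
    have "\<phi> (vadd X x (minus_vec c)) = \<phi> x - \<phi> c"
      using \<phi>(1) x CX[OF c] by (simp add: dual_on_def smul_closed)
    then show ?thesis
      using \<phi>(3)[of "vadd X x (minus_vec c)"] c by (simp add: K_def)
  qed
  with \<phi> that show ?thesis by blast
qed

end

subsection \<open>Bushes and Stegall's variational principle\<close>

text \<open>Repeated averaging over descendants moves each point by at most
  \<open>2 * \<kappa>\<close> and converges to an exact bush. Of the distance
  \<open>8 * \<kappa>\<close> between a point and its children at least \<open>4 * \<kappa>\<close>
  survives. A half-space containing a point of the exact bush also contains one of its children, so
  no slice has diameter below \<open>4 * \<kappa>\<close>.\<close>

lemma approximate_bush_not_dentable:
  fixes D :: "'y::banach set" and P :: "nat \<Rightarrow> 'y set"
  assumes D: "closed D" "convex D" and \<kappa>: "\<kappa> > 0"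
    and PD: "\<And>n. P n \<subseteq> D" and bdd: "bounded (\<Union>n. P n)" and ne: "P 0 \<noteq> {}"
    and step: "\<And>n y. y \<in> P n \<Longrightarrow>
      \<exists>z \<in> convex hull (P (Suc n) - ball y (8 * \<kappa>)). dist y z < \<kappa> / 2 ^ n"
  shows "\<not> dentable_on type_space D (\<lambda>y. y)"
proof
  assume dent: "dentable_on type_space D (\<lambda>y. y)"
  define comb where "comb n y S u \<longleftrightarrow> finite S \<and> S \<subseteq> P (Suc n) - ball y (8 * \<kappa>) \<and>
      (\<forall>z\<in>S. 0 \<le> u z) \<and> sum u S = 1 \<and> dist y (\<Sum>z\<in>S. u z *\<^sub>R z) < \<kappa> / 2 ^ n" for n y S u
  have ex: "\<exists>p. comb n y (fst p) (snd p)" if y: "y \<in> P n" for n y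
  proof -
    obtain z where "z \<in> convex hull (P (Suc n) - ball y (8 * \<kappa>))" "dist y z < \<kappa> / 2 ^ n"
      using step[OF y] by blast
    then show ?thesis
      by (auto simp: convex_hull_explicit comb_def)
  qed
  \<comment> \<open>The children \<open>S n y\<close> and weights \<open>u n y\<close> are fixed
    once and for all; the correction only changes the positions of the points.\<close>
  define S where "S n y = fst (SOME p. comb n y (fst p) (snd p))" for n y
  define u where "u n y = snd (SOME p. comb n y (fst p) (snd p))" for n y
  have "comb n y (S n y) (u n y)" if "y \<in> P n" for n y
    unfolding S_def u_def by (rule someI_ex[OF ex[OF that]])
  then have fin: "\<And>n y. y \<in> P n \<Longrightarrow> finite (S n y)"
    and S: "\<And>n y. y \<in> P n \<Longrightarrow> S n y \<subseteq> P (Suc n) - ball y (8 * \<kappa>)"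
    and u: "\<And>n y z. y \<in> P n \<Longrightarrow> z \<in> S n y \<Longrightarrow> 0 \<le> u n y z"
    and u_sum: "\<And>n y. y \<in> P n \<Longrightarrow> sum (u n y) (S n y) = 1"
    and near: "\<And>n y. y \<in> P n \<Longrightarrow> dist y (\<Sum>z\<in>S n y. u n y z *\<^sub>R z) < \<kappa> / 2 ^ n"
    by (simp_all add: comb_def)
  have child: "z \<in> P (Suc n)" if "y \<in> P n" "z \<in> S n y" for n y z
    using S that by blast
  \<comment> \<open>The exact bush is a fixed point of \<open>T\<close>, reached by iterating \<open>T\<close> from the approximate bush.\<close>
  define T where "T h n y = (\<Sum>z\<in>S n y. u n y z *\<^sub>R h (Suc n) z)" for h :: "nat \<Rightarrow> 'y \<Rightarrow> 'y" and n y
  define g where "g k = (T ^^ k) (\<lambda>n y. y)" for k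
  have g0: "g 0 n y = y" for n y
    by (simp add: g_def)
  have gSuc: "g (Suc k) n y = (\<Sum>z\<in>S n y. u n y z *\<^sub>R g k (Suc n) z)" for k n y
    by (simp add: g_def T_def)
  have gD: "g k n y \<in> D" if "y \<in> P n" for k n y
    using that
  proof (induction k arbitrary: n y)
    case 0
    then show ?case using PD g0 by auto
  next
    case (Suc k)
    then show ?case
      unfolding gSuc using child fin u u_sum D by (intro convex_sum) auto
  qed
  \<comment> \<open>The \<open>k\<close>-th correction at level \<open>n\<close> averages the
    defects \<open>k\<close> levels further down, each at most
    \<open>\<kappa> / 2 ^ (n + k)\<close>.\<close>
  have g_diff: "norm (g (Suc k) n y - g k n y) \<le> \<kappa> / 2 ^ n * (1 / 2) ^ k" if "y \<in> P n" for k n y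
    using that
  proof (induction k arbitrary: n y)
    case 0
    then show ?case
      using near[OF 0] by (simp add: gSuc g0 dist_norm norm_minus_commute)
  next
    case (Suc k)
    have "g (Suc (Suc k)) n y - g (Suc k) n y
        = (\<Sum>z\<in>S n y. u n y z *\<^sub>R (g (Suc k) (Suc n) z - g k (Suc n) z))"
      unfolding gSuc[of "Suc k"] gSuc[of k n y]
      by (simp add: scaleR_diff_right sum_subtractf)
    also have "norm \<dots> \<le> (\<Sum>z\<in>S n y. u n y z * (\<kappa> / 2 ^ Suc n * (1 / 2) ^ k))"
    proof (rule sum_norm_le)
      fix z assume z: "z \<in> S n y"
      show "norm (u n y z *\<^sub>R (g (Suc k) (Suc n) z - g k (Suc n) z))
          \<le> u n y z * (\<kappa> / 2 ^ Suc n * (1 / 2) ^ k)"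
        using mult_left_mono[OF Suc.IH[OF child[OF Suc.prems z]] u[OF Suc.prems z]]
          u[OF Suc.prems z] by simp
    qed
    also have "\<dots> = \<kappa> / 2 ^ n * (1 / 2) ^ Suc k"
      unfolding sum_distrib_right[symmetric] u_sum[OF Suc.prems] by simp
    finally show ?case .
  qed
  define l where "l n y = y + (\<Sum>k. g (Suc k) n y - g k n y)" for n y
  have sm: "summable (\<lambda>k. \<kappa> / 2 ^ n * (1 / 2) ^ k)" for n
    by (intro summable_mult summable_geometric) simp
  have g_lim: "(\<lambda>k. g k n y) \<longlonglongrightarrow> l n y" if y: "y \<in> P n" for n y
  proof -
    have "summable (\<lambda>k. g (Suc k) n y - g k n y)"
      using g_diff[OF y] by (intro summable_comparison_test'[OF sm])
    then have "(\<lambda>K. \<Sum>k<K. g (Suc k) n y - g k n y) \<longlonglongrightarrow> (\<Sum>k. g (Suc k) n y - g k n y)"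
      by (rule summable_LIMSEQ)
    then have "(\<lambda>K. y + (g K n y - g 0 n y)) \<longlonglongrightarrow> l n y"
      unfolding l_def sum_lessThan_telescope[of "\<lambda>k. g k n y", symmetric] by (intro tendsto_add tendsto_const)
    then show ?thesis
      by (simp add: g0)
  qed
  have l_near: "dist (l n y) y \<le> 2 * \<kappa>" if y: "y \<in> P n" for n y
  proof -
    have "dist (l n y) y \<le> (\<Sum>k. \<kappa> / 2 ^ n * (1 / 2) ^ k)"
      using norm_suminf_le[OF g_diff[OF y] sm] by (simp add: l_def dist_norm)
    also have "\<dots> = \<kappa> / 2 ^ n * 2"
      by (subst suminf_mult) (simp_all add: summable_geometric suminf_geometric)
    also have "\<dots> \<le> 2 * \<kappa>"
      using \<kappa> by (simp add: field_simps)
    finally show ?thesis .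
  qed
  have l_eq: "l n y = (\<Sum>z\<in>S n y. u n y z *\<^sub>R l (Suc n) z)" if y: "y \<in> P n" for n y
  proof (rule LIMSEQ_unique)
    show "(\<lambda>k. g (Suc k) n y) \<longlonglongrightarrow> l n y"
      using g_lim[OF y] by (rule LIMSEQ_Suc)
    show "(\<lambda>k. g (Suc k) n y) \<longlonglongrightarrow> (\<Sum>z\<in>S n y. u n y z *\<^sub>R l (Suc n) z)"
      unfolding gSuc by (intro tendsto_sum tendsto_scaleR tendsto_const g_lim child[OF y])
  qed
  define W where "W = {l n y |n y. y \<in> P n}"
  have "W \<noteq> {}"
    using ne by (auto simp: W_def)
  moreover have "W \<subseteq> D"
    using closed_sequentially[OF D(1) gD g_lim] by (auto simp: W_def)
  moreover have W_bdd: "bounded W"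
  proof -
    obtain B where B: "\<And>n y. y \<in> P n \<Longrightarrow> norm y \<le> B"
      using bdd by (auto simp: bounded_iff)
    have "norm (l n y) \<le> B + 2 * \<kappa>" if "y \<in> P n" for n y
      using B[OF that] l_near[OF that] norm_triangle_ineq2[of "l n y" y] by (simp add: dist_norm)
    then show ?thesis
      by (auto simp: bounded_iff W_def)
  qed
  ultimately obtain H where H: "open_half_space_on type_space H" "W \<inter> H \<noteq> {}"
    "diameter (W \<inter> H) < 4 * \<kappa>"
    using dent[unfolded dentable_on_def bounded_on_type_space, rule_format, of W "4 * \<kappa>"] \<kappa>
    by auto
  obtain \<phi> :: "'y \<Rightarrow> real" and a where \<phi>: "bounded_linear \<phi>" and H_eq: "H = {x. \<phi> x > a}"
    using H(1) unfolding open_half_space_on_def dual_on_type_space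
    by (auto simp: type_space_def)
  obtain n y where y: "y \<in> P n" and ly: "\<phi> (l n y) > a"
    using H(2) by (auto simp: W_def H_eq)
  \<comment> \<open>If every child had value at most \<open>a\<close>, so would their average
    \<open>l n y\<close>.\<close>
  have "\<exists>z\<in>S n y. \<phi> (l (Suc n) z) > a"
  proof (rule ccontr)
    assume "\<not> ?thesis"
    then have "(\<Sum>z\<in>S n y. u n y z * \<phi> (l (Suc n) z)) \<le> (\<Sum>z\<in>S n y. u n y z * a)"
      using u[OF y] by (intro sum_mono mult_left_mono) (auto simp: not_less)
    moreover have "\<phi> (l n y) = (\<Sum>z\<in>S n y. u n y z * \<phi> (l (Suc n) z))"
      using \<phi> by (subst l_eq[OF y]) (simp add: bounded_linear.linear linear_sum linear_cmul)
    ultimately show False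
      using ly by (simp add: sum_distrib_right[symmetric] u_sum[OF y])
  qed
  then obtain z where z: "z \<in> S n y" "\<phi> (l (Suc n) z) > a"
    by blast
  have "8 * \<kappa> \<le> dist y z"
    using S[OF y] z(1) by auto
  also have "dist y z \<le> dist (l n y) y + dist (l n y) (l (Suc n) z) + dist (l (Suc n) z) z"
    by metric
  finally have "4 * \<kappa> \<le> dist (l n y) (l (Suc n) z)"
    using l_near[OF y] l_near[OF child[OF y z(1)]] by linarith
  also have "\<dots> \<le> diameter (W \<inter> H)"
  proof (rule diameter_bounded_bound)
    show "bounded (W \<inter> H)"
      using W_bdd by (simp add: bounded_Int)
    show "l n y \<in> W \<inter> H" "l (Suc n) z \<in> W \<inter> H"
      using y ly z(2) child[OF y z(1)] unfolding W_def H_eq by blast+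
  qed
  finally show False
    using H(3) by simp
qed

text \<open>Brings separation into the type of bounded functionals. The bound 1 on the norm together
  with the full gap \<open>r\<close> is what the perturbation argument consumes.\<close>

lemma separation_banach:
  fixes C :: "'y::banach set"
  assumes "convex C" and "\<And>c. c \<in> C \<Longrightarrow> r \<le> dist x c"
  obtains \<phi> :: "'y \<Rightarrow>\<^sub>L real" where "norm \<phi> \<le> 1" "\<And>c. c \<in> C \<Longrightarrow> \<phi> c + r \<le> \<phi> x"
proof -
  interpret banach_space_on "type_space :: 'y normed_data"
    by (rule banach_space_on_type_space)
  have "convex_set_on type_space C"
    using assms(1) by (auto simp: convex_set_on_def type_space_def convex_alt)
  then obtain \<phi> where \<phi>: "\<phi> \<in> dual_on type_space"
    "\<And>y. y \<in> points type_space \<Longrightarrow> \<bar>\<phi> y\<bar> \<le> vnorm type_space y"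
    "\<And>c. c \<in> C \<Longrightarrow> \<phi> c + r \<le> \<phi> x"
    using separation_from_point[of C x r] assms(2)
    by (auto simp: vdist_type_space) (auto simp: type_space_def)
  have bl: "bounded_linear \<phi>"
    using \<phi>(1) by (simp add: dual_on_type_space)
  show ?thesis
  proof
    show "norm (Blinfun \<phi>) \<le> 1"
      using \<phi>(2) by (intro norm_blinfun_bound) (auto simp: bounded_linear_Blinfun_apply[OF bl] type_space_def)
    show "\<And>c. c \<in> C \<Longrightarrow> Blinfun \<phi> c + r \<le> Blinfun \<phi> x"
      using \<phi>(3) by (simp add: bounded_linear_Blinfun_apply[OF bl])
  qed
qed

text \<open>The variational step, carried out on a bare set \<open>A\<close>: it yields a superlevel
  set, which convexity turns into a slice only later.\<close>

lemma small_slice_exists: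
  fixes F :: "'a \<Rightarrow> 'y::banach" and f :: "'a \<Rightarrow> real"
  assumes D: "radon_nikodym_property D" "closed D" "convex D"
    and A: "A \<noteq> {}" and FD: "F ` A \<subseteq> D" and F_bdd: "bounded (F ` A)" and f_bdd: "bounded (f ` A)"
    and \<epsilon>: "\<epsilon> > 0"
  obtains \<psi> :: "'y \<Rightarrow>\<^sub>L real" and a where "norm \<psi> \<le> 1" "\<exists>x\<in>A. f x + \<psi> (F x) > a"
    "diameter (F ` {x \<in> A. f x + \<psi> (F x) > a}) < \<epsilon>"
proof -
  \<comment> \<open>The near-maximisers up to \<open>\<delta>\<close>, phrased by comparison with
    every point of \<open>A\<close> so that two of them can be played off directly.\<close>
  define near where "near \<psi> \<delta> = {x \<in> A. \<forall>z\<in>A. f z + blinfun_apply \<psi> (F z) < f x + blinfun_apply \<psi> (F x) + \<delta>}"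
    for \<psi> :: "'y \<Rightarrow>\<^sub>L real" and \<delta> :: real
  have near_ne: "near \<psi> \<delta> \<noteq> {}" if \<delta>: "\<delta> > 0" for \<psi> \<delta>
  proof -
    define h where "h x = f x + blinfun_apply \<psi> (F x)" for x
    have "bounded (blinfun_apply \<psi> ` (F ` A))"
      using F_bdd by (rule bounded_linear_image) (rule blinfun.bounded_linear_right)
    then have "bounded (h ` A)"
      using bounded_plus_comp[OF f_bdd, of "\<lambda>x. \<psi> (F x)"] by (simp add: h_def image_image)
    then have bdd: "bdd_above (h ` A)"
      by (rule bounded_imp_bdd_above)
    obtain x where x: "x \<in> A" "Sup (h ` A) - \<delta> < h x"
      using less_cSUP_iff[OF A bdd, of "Sup (h ` A) - \<delta>"] \<delta> by auto
    have "h z < h x + \<delta>" if "z \<in> A" for z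
      using cSUP_upper[OF that bdd] x by linarith
    then show ?thesis
      using x by (auto simp: near_def h_def)
  qed
  have "\<exists>\<psi> \<delta>. norm \<psi> \<le> 1 \<and> \<delta> > 0 \<and> diameter (F ` near \<psi> \<delta>) < \<epsilon>"
  proof (rule ccontr)
    assume neg: "\<not> ?thesis"
    \<comment> \<open>Values that all lie within \<open>\<epsilon> / 3\<close> of some
      \<open>y\<close> have diameter at most \<open>2 * \<epsilon> / 3\<close>.\<close>
    have far: "\<exists>z\<in>near \<psi> \<delta>. \<epsilon> / 3 \<le> dist y (F z)" if "norm \<psi> \<le> 1" "\<delta> > 0" for \<psi> \<delta> y
    proof (rule ccontr)
      assume "\<not> ?thesis"
      then have small: "dist y (F z) < \<epsilon> / 3" if "z \<in> near \<psi> \<delta>" for z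
        using that by force
      have "diameter (F ` near \<psi> \<delta>) \<le> 2 * \<epsilon> / 3"
      proof (rule diameter_le)
        show "F ` near \<psi> \<delta> \<noteq> {} \<or> 0 \<le> 2 * \<epsilon> / 3"
          using \<epsilon> by simp
        fix v w assume "v \<in> F ` near \<psi> \<delta>" "w \<in> F ` near \<psi> \<delta>"
        then have "dist y v < \<epsilon> / 3" "dist y w < \<epsilon> / 3"
          using small by auto
        then have "dist v w \<le> 2 * \<epsilon> / 3"
          using dist_triangle3[of v w y] by linarith
        then show "norm (v - w) \<le> 2 * \<epsilon> / 3"
          by (simp add: dist_norm)
      qed
      then have "diameter (F ` near \<psi> \<delta>) < \<epsilon>"
        using \<epsilon> by linarith
      then show False
        using neg that by blast
    qed
    \<comment> \<open>Chosen so that \<open>8 * \<kappa>\<close> is the distance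
      \<open>\<epsilon> / 3\<close> supplied by \<open>far\<close>.\<close>
    define \<kappa> where "\<kappa> = \<epsilon> / 24"
    have \<kappa>: "\<kappa> > 0"
      using \<epsilon> by (simp add: \<kappa>_def)
    \<comment> \<open>A perturbation of size \<open>(1/2) ^ Suc n\<close> against a gap
      \<open>\<kappa> / 2 ^ n\<close> gains half of \<open>\<kappa> / 4 ^ n\<close>, while
      \<open>\<delta> n + \<delta> (Suc n)\<close> is only \<open>5 / 16\<close> of it.\<close>
    define \<delta> where "\<delta> n = \<kappa> / 4 ^ Suc n" for n
    have \<delta>: "\<delta> n > 0" for n
      using \<kappa> by (simp add: \<delta>_def)
    \<comment> \<open>The norm bound leaves exactly \<open>(1/2) ^ Suc n\<close> to spend on passing
      to the next level, so all functionals stay in the unit ball; at level 0 only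
      \<open>\<psi> = 0\<close> is allowed.\<close>
    define P where "P n = {F x |x \<psi>. norm \<psi> \<le> 1 - (1/2) ^ n \<and> x \<in> near \<psi> (\<delta> n)}" for n :: nat
    have "\<not> dentable_on type_space D (\<lambda>y. y)"
    proof (rule approximate_bush_not_dentable[OF D(2,3) \<kappa>, of P])
      have PA: "P n \<subseteq> F ` A" for n
        by (auto simp: P_def near_def)
      then show "P n \<subseteq> D" for n
        using FD by blast
      show "bounded (\<Union>n. P n)"
        using F_bdd by (rule bounded_subset) (use PA in blast)
      show "P 0 \<noteq> {}"
        using near_ne[OF \<delta>, of 0 0] by (auto simp: P_def intro!: exI[of _ 0])
      fix n y assume "y \<in> P n"
      then obtain x \<psi> where y: "y = F x" and \<psi>: "norm \<psi> \<le> 1 - (1/2) ^ n" and x: "x \<in> near \<psi> (\<delta> n)"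
        by (auto simp: P_def)
      show "\<exists>z \<in> convex hull (P (Suc n) - ball y (8 * \<kappa>)). dist y z < \<kappa> / 2 ^ n"
      proof (rule ccontr)
        assume "\<not> ?thesis"
        then have "\<kappa> / 2 ^ n \<le> dist y z" if "z \<in> convex hull (P (Suc n) - ball y (8 * \<kappa>))" for z
          using that by force
        then obtain \<phi> :: "'y \<Rightarrow>\<^sub>L real" where \<phi>: "norm \<phi> \<le> 1"
          "\<And>z. z \<in> convex hull (P (Suc n) - ball y (8 * \<kappa>)) \<Longrightarrow> \<phi> z + \<kappa> / 2 ^ n \<le> \<phi> y"
          using separation_banach[OF convex_convex_hull] by metis
        \<comment> \<open>The perturbation favours \<open>y\<close> over the values in
          \<open>P (Suc n)\<close> far from it, yet by \<open>far\<close> some near-maximiser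
          \<open>z\<close> of the new functional has such a value. Comparing \<open>x\<close> and
          \<open>z\<close> under both functionals gives the contradiction.\<close>
        define \<psi>' where "\<psi>' = \<psi> + (1/2) ^ Suc n *\<^sub>R \<phi>"
        have "norm \<psi>' \<le> norm \<psi> + (1/2) ^ Suc n * norm \<phi>"
          unfolding \<psi>'_def by (rule order_trans[OF norm_triangle_ineq]) simp
        also have "\<dots> \<le> 1 - (1/2) ^ n + (1/2) ^ Suc n * 1"
          using \<psi> \<phi>(1) by (intro add_mono mult_left_mono) auto
        finally have \<psi>': "norm \<psi>' \<le> 1 - (1/2) ^ Suc n"
          by simp
        then have "norm \<psi>' \<le> 1"
          by (rule order_trans) simp
        then obtain z where z: "z \<in> near \<psi>' (\<delta> (Suc n))" "\<epsilon> / 3 \<le> dist y (F z)"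
          using far \<delta> by blast
        have "F z \<in> P (Suc n) - ball y (8 * \<kappa>)"
          using z \<psi>' by (auto simp: P_def \<kappa>_def)
        then have "\<phi> (F z) + \<kappa> / 2 ^ n \<le> \<phi> y"
          by (intro \<phi>(2) hull_inc)
        then have "(1/2) ^ Suc n * (\<kappa> / 2 ^ n) \<le> (1/2) ^ Suc n * (\<phi> y - \<phi> (F z))"
          by (intro mult_left_mono) auto
        also have "\<dots> < \<delta> n + \<delta> (Suc n)"
        proof -
          have "f z + \<psi> (F z) < f x + \<psi> (F x) + \<delta> n"
            "f x + \<psi>' (F x) < f z + \<psi>' (F z) + \<delta> (Suc n)"
            using x z(1) by (auto simp: near_def)
          then show ?thesis
            by (simp add: \<psi>'_def y blinfun.add_left blinfun.scaleR_left algebra_simps)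
        qed
        also have "\<dots> \<le> (1/2) ^ Suc n * (\<kappa> / 2 ^ n)"
        proof -
          have "(1/2) ^ Suc n * (\<kappa> / 2 ^ n) = \<kappa> / 4 ^ n / 2"
            by (simp add: power_one_over power_mult_distrib[symmetric] field_simps)
          moreover have "\<delta> n + \<delta> (Suc n) = \<kappa> / 4 ^ n * (5 / 16)"
            by (simp add: \<delta>_def)
          moreover have "\<kappa> / 4 ^ n > 0"
            using \<kappa> by simp
          ultimately show ?thesis
            by (simp only: divide_inverse) simp
        qed
        finally show False by simp
      qed
    qed
    then show False
      using D(1) by (simp add: radon_nikodym_property_def)
  qed
  then obtain \<psi> \<delta> where \<psi>: "norm \<psi> \<le> 1" and \<delta>: "\<delta> > 0" and diam: "diameter (F ` near \<psi> \<delta>) < \<epsilon>"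
    by blast
  obtain x where x: "x \<in> near \<psi> (\<delta> / 2)"
    using near_ne[of "\<delta> / 2" \<psi>] \<delta> by auto
  \<comment> \<open>One half of \<open>\<delta>\<close> is the error of \<open>x\<close> as a
    maximiser, the other the depth of the slice below \<open>x\<close>.\<close>
  define a where "a = f x + \<psi> (F x) - \<delta> / 2"
  have sub: "{w \<in> A. f w + \<psi> (F w) > a} \<subseteq> near \<psi> \<delta>"
  proof
    fix w assume w: "w \<in> {w \<in> A. f w + \<psi> (F w) > a}"
    have "f z + \<psi> (F z) < f w + \<psi> (F w) + \<delta>" if "z \<in> A" for z
    proof -
      have "f z + \<psi> (F z) < f x + \<psi> (F x) + \<delta> / 2"
        using x that by (simp add: near_def)
      then show ?thesis
        using w by (simp add: a_def)
    qed
    then show "w \<in> near \<psi> \<delta>"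
      using w by (simp add: near_def)
  qed
  show ?thesis
  proof
    show "norm \<psi> \<le> 1" by (rule \<psi>)
    show "\<exists>x\<in>A. f x + \<psi> (F x) > a"
      using x \<delta> by (auto simp: near_def a_def intro!: bexI[of _ x])
    have "bounded (F ` near \<psi> \<delta>)"
      using F_bdd by (rule bounded_subset) (auto simp: near_def)
    then show "diameter (F ` {x \<in> A. f x + \<psi> (F x) > a}) < \<epsilon>"
      using diameter_subset[OF image_mono[OF sub, of F]] diam by linarith
  qed
qed

subsection \<open>Slices of superlevel sets\<close>

context normed_space_on
begin

text \<open>Convexity of \<open>h\<close> makes the sublevel set \<open>K\<close> convex, and
  continuity keeps \<open>x\<close> at positive distance from it; the half-space comes from
  separating \<open>x\<close> from \<open>K\<close>.\<close>

lemma half_space_inside_superlevel: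
  assumes C: "convex_set_on X C" and A: "A \<subseteq> C"
    and h: "convex_function_on X C h" "continuous_function_on X C h"
    and x: "x \<in> A" "h x > a"
  obtains H where "open_half_space_on X H" "x \<in> H" "A \<inter> H \<subseteq> {y \<in> A. h y > a}"
proof -
  interpret Metric_space "points X" "vdist X"
    by (rule Metric_space_vdist)
  have CX: "C \<subseteq> points X"
    using C by (simp add: convex_set_on_def)
  have xX: "x \<in> points X" "x \<in> C"
    using A CX x by auto
  define K where "K = {y \<in> C. h y \<le> a}"
  have "convex_set_on X K"
    unfolding convex_set_on_def
  proof (intro conjI ballI)
    show "K \<subseteq> points X"
      using CX by (auto simp: K_def)
    fix y z and t :: real assume y: "y \<in> K" and z: "z \<in> K" and t: "t \<in> {0..1}"
    let ?w = "vadd X (smul X (1 - t) y) (smul X t z)"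
    have "?w \<in> C"
      using C y z t by (auto simp: convex_set_on_def K_def)
    moreover have "h ?w \<le> (1 - t) * h y + t * h z"
      using h(1) y z t by (auto simp: convex_function_on_def K_def)
    moreover have "(1 - t) * h y + t * h z \<le> (1 - t) * a + t * a"
      using y z t by (intro add_mono mult_left_mono) (auto simp: K_def)
    ultimately show "?w \<in> K"
      by (simp add: K_def algebra_simps)
  qed
  moreover obtain r where r: "r > 0" "\<And>y. y \<in> K \<Longrightarrow> r \<le> vdist X x y"
  proof -
    have "openin (subtopology mtopology C) {y \<in> topspace (subtopology mtopology C). h y \<in> {a<..}}"
      using h(2) unfolding continuous_function_on_def norm_topology_def
      by (rule openin_continuous_map_preimage) simp
    then obtain U where U: "openin mtopology U"
      "{y \<in> topspace (subtopology mtopology C). h y \<in> {a<..}} = U \<inter> C"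
      by (auto simp: openin_subtopology)
    then have U_eq: "{y \<in> C. h y > a} = U \<inter> C"
      using CX by auto
    then obtain r where "r > 0" "mball x r \<subseteq> U"
      using U(1) x(2) xX by (auto simp: openin_mtopology)
    moreover have "r \<le> vdist X x y" if y: "y \<in> K" for y
    proof (rule ccontr)
      assume "\<not> ?thesis"
      then have "y \<in> U"
        using y xX CX \<open>mball x r \<subseteq> U\<close> by (auto simp: K_def subset_iff)
      then have "y \<in> {y \<in> C. h y > a}"
        using y U_eq by (simp add: K_def)
      then show False
        using y by (simp add: K_def)
    qed
    ultimately show ?thesis
      using that by blast
  qed
  ultimately obtain \<phi> where \<phi>: "\<phi> \<in> dual_on X" "\<And>c. c \<in> K \<Longrightarrow> \<phi> c + r \<le> \<phi> x"
    using separation_from_point[of K x r] xX by metis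
  show ?thesis
  proof
    show "open_half_space_on X {y \<in> points X. \<phi> y > \<phi> x - r}"
      using \<phi>(1) by (auto simp: open_half_space_on_def)
    show "x \<in> {y \<in> points X. \<phi> y > \<phi> x - r}"
      using r xX by simp
    show "A \<inter> {y \<in> points X. \<phi> y > \<phi> x - r} \<subseteq> {y \<in> A. h y > a}"
      using A \<phi>(2) by (force simp: K_def)
  qed
qed

end

text \<open>Control functions are tested on unit functionals only. For a unit vector
  \<open>v\<close> in the direction of \<open>\<psi>\<close>, the function in question is a convex
  combination of those for \<open>v\<close> and \<open>- v\<close>; \<open>u\<close> supplies a
  direction when \<open>\<psi> = 0\<close>.\<close>

lemma control_function_on_subunit:
  fixes F :: "'a \<Rightarrow> 'y::banach" and \<psi> :: "'y \<Rightarrow>\<^sub>L real"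
  assumes f: "control_function_on X C F f" and \<psi>: "norm \<psi> \<le> 1" and u: "norm (u :: 'y \<Rightarrow>\<^sub>L real) = 1"
  shows "convex_function_on X C (\<lambda>x. f x + \<psi> (F x))"
    "continuous_function_on X C (\<lambda>x. f x + \<psi> (F x))"
proof -
  obtain v :: "'y \<Rightarrow>\<^sub>L real" where v: "norm v = 1" "\<psi> = norm \<psi> *\<^sub>R v"
  proof (cases "\<psi> = 0")
    case True
    with u that show ?thesis by auto
  next
    case False
    then show ?thesis
      by (intro that[of "\<psi> /\<^sub>R norm \<psi>"]) auto
  qed
  \<comment> \<open>The weight solving \<open>c - (1 - c) = norm \<psi>\<close>.\<close>
  define c where "c = (1 + norm \<psi>) / 2"
  have c: "0 \<le> c" "c \<le> 1"
    using \<psi> by (auto simp: c_def)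
  have pt: "f x + \<psi> (F x) = c * (f x + v (F x)) + (1 - c) * (f x + (- v) (F x))" for x
    by (subst v(2)) (simp add: c_def blinfun.scaleR_left blinfun.minus_left field_simps)
  then have eq: "(\<lambda>x. f x + \<psi> (F x))
      = (\<lambda>x. c * (f x + v (F x)) + (1 - c) * (f x + (- v) (F x)))"
    by blast
  have v_pm: "convex_function_on X C (\<lambda>x. f x + w (F x))"
    "continuous_function_on X C (\<lambda>x. f x + w (F x))" if "norm w = 1" for w :: "'y \<Rightarrow>\<^sub>L real"
    using f that by (auto simp: control_function_on_def)
  show "continuous_function_on X C (\<lambda>x. f x + \<psi> (F x))"
    using v_pm(2)[of v] v_pm(2)[of "- v"] v(1) unfolding eq continuous_function_on_def
    by (simp add: continuous_map_add continuous_map_real_mult_left del: blinfun.minus_left)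
  show "convex_function_on X C (\<lambda>x. f x + \<psi> (F x))"
    unfolding convex_function_on_def
  proof (intro ballI)
    fix x y and t :: real assume xy: "x \<in> C" "y \<in> C" "t \<in> {0..1}"
    let ?w = "vadd X (smul X (1 - t) x) (smul X t y)"
    have *: "f ?w + w (F ?w) \<le> (1 - t) * (f x + w (F x)) + t * (f y + w (F y))"
      if "norm w = 1" for w :: "'y \<Rightarrow>\<^sub>L real"
      using v_pm(1)[OF that] xy by (auto simp: convex_function_on_def)
    have "f ?w + \<psi> (F ?w) = c * (f ?w + v (F ?w)) + (1 - c) * (f ?w + (- v) (F ?w))"
      by (rule pt)
    also have "\<dots> \<le> c * ((1 - t) * (f x + v (F x)) + t * (f y + v (F y)))
        + (1 - c) * ((1 - t) * (f x + (- v) (F x)) + t * (f y + (- v) (F y)))"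
      using *[of v] *[of "- v"] v(1) c
      by (intro add_mono[OF mult_left_mono mult_left_mono]) (auto simp del: blinfun.minus_left)
    also have "\<dots> = (1 - t) * (c * (f x + v (F x)) + (1 - c) * (f x + (- v) (F x)))
        + t * (c * (f y + v (F y)) + (1 - c) * (f y + (- v) (F y)))"
      by (simp add: algebra_simps)
    also have "\<dots> = (1 - t) * (f x + \<psi> (F x)) + t * (f y + \<psi> (F y))"
      by (simp only: pt)
    finally show "f ?w + \<psi> (F ?w) \<le> (1 - t) * (f x + \<psi> (F x)) + t * (f y + \<psi> (F y))" .
  qed
qed

text \<open>Separating \<open>y\<close> from \<open>0\<close> with gap \<open>norm y\<close> gives a
  nonzero functional, which is then normalised.\<close>

lemma norm_one_functional_exists:
  fixes y :: "'y::banach"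
  assumes "y \<noteq> 0"
  obtains u :: "'y \<Rightarrow>\<^sub>L real" where "norm u = 1"
proof -
  obtain \<phi> :: "'y \<Rightarrow>\<^sub>L real" where "\<And>c. c \<in> {0} \<Longrightarrow> \<phi> c + norm y \<le> \<phi> y"
    by (rule separation_banach[of "{0}" "norm y" y]) auto
  then have "\<phi> \<noteq> 0"
    using assms by auto
  then show ?thesis
    by (intro that[of "\<phi> /\<^sub>R norm \<phi>"]) auto
qed

section \<open>From the Radon-Nikodym property to dentability\<close>

lemma DC_bounded_imp_dentable:
  fixes D :: "'y::banach set"
  assumes D: "radon_nikodym_property D" "closed D" "convex D"
    and X: "normed_space_on X" and C: "convex_set_on X C"
    and F: "DC_bounded_on X C F" "F ` C \<subseteq> D"
  shows "dentable_on X C F"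
  unfolding dentable_on_def
proof (intro allI impI, elim conjE)
  fix A and \<epsilon> :: real
  assume A: "A \<noteq> {}" "A \<subseteq> C" "bounded_on X A" and \<epsilon>: "\<epsilon> > 0"
  interpret normed_space_on X by (rule X)
  have AX: "A \<subseteq> points X"
    using A(3) by (simp add: bounded_on_def)
  show "\<exists>H. open_half_space_on X H \<and> A \<inter> H \<noteq> {} \<and>
      bounded (F ` (A \<inter> H)) \<and> diameter (F ` (A \<inter> H)) < \<epsilon>"
  proof (cases "\<exists>u :: 'y \<Rightarrow>\<^sub>L real. norm u = 1")
    case False
    \<comment> \<open>For \<open>Y = {0}\<close> there are no functionals of norm one, so being a control function is vacuous.\<close>
    then have zero: "y = 0" for y :: 'y
      using norm_one_functional_exists by blast
    \<comment> \<open>The zero functional with level -1 makes the whole carrier a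
      half-space.\<close>
    have "open_half_space_on X (points X)"
      unfolding open_half_space_on_def
      by (intro bexI[of _ "\<lambda>_. 0"] exI[of _ "-1"]) (auto simp: dual_on_def intro!: exI[of _ 0])
    moreover have "F ` (A \<inter> points X) = {0}"
      using A(1) AX zero by force
    ultimately show ?thesis
      using A(1) AX \<epsilon> by (intro exI[of _ "points X"]) auto
  next
    case True
    then obtain u :: "'y \<Rightarrow>\<^sub>L real" where u: "norm u = 1" ..
    obtain f where f: "control_function_on X C F f" "bounded (f ` C)" and Fb: "bounded (F ` C)"
      using F(1) by (auto simp: DC_bounded_on_def)
    have bdd: "bounded (F ` A)" "bounded (f ` A)"
      using A(2) Fb f(2) by (auto intro: bounded_subset)
    have FA: "F ` A \<subseteq> D"
      using A(2) F(2) by blast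
    obtain \<psi> :: "'y \<Rightarrow>\<^sub>L real" and a where \<psi>: "norm \<psi> \<le> 1"
      and ex: "\<exists>x\<in>A. f x + \<psi> (F x) > a"
      and diam: "diameter (F ` {x \<in> A. f x + \<psi> (F x) > a}) < \<epsilon>"
      by (rule small_slice_exists[OF D A(1) FA bdd \<epsilon>])
    obtain x where x: "x \<in> A" "f x + \<psi> (F x) > a"
      using ex by blast
    obtain H where H: "open_half_space_on X H" "x \<in> H"
      "A \<inter> H \<subseteq> {y \<in> A. f y + \<psi> (F y) > a}"
      using half_space_inside_superlevel[OF C A(2) control_function_on_subunit[OF f(1) \<psi> u] x] .
    have "bounded (F ` {y \<in> A. f y + \<psi> (F y) > a})"
      using bdd(1) by (rule bounded_subset) auto
    then have "diameter (F ` (A \<inter> H)) < \<epsilon>"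
      using diameter_subset[OF image_mono[OF H(3), of F]] diam by linarith
    moreover have "bounded (F ` (A \<inter> H))"
      using bdd(1) by (rule bounded_subset) auto
    ultimately show ?thesis
      using H x by (intro exI[of _ H]) auto
  qed
qed

subsection \<open>The copy of the range space inside the sum type\<close>

text \<open>The space \<open>'y\<close> transported along \<open>Inl\<close> into the type whose
  carriers the theorem ranges over; \<open>projl\<close> plays the identity, and its values off
  \<open>range Inl\<close> never matter.\<close>

definition Inl_space :: "('y::real_normed_vector + 'u) normed_data" where
  "Inl_space = \<lparr>points = range Inl, vadd = (\<lambda>a b. Inl (projl a + projl b)), vzero = Inl 0,
     smul = (\<lambda>c a. Inl (c *\<^sub>R projl a)), vnorm = (\<lambda>a. norm (projl a))\<rparr>"

lemma Inl_space_simps: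
  "points Inl_space = range Inl" "vadd Inl_space a b = Inl (projl a + projl b)"
  "vzero Inl_space = Inl 0" "smul Inl_space c a = Inl (c *\<^sub>R projl a)"
  "vnorm Inl_space a = norm (projl a)"
  by (simp_all add: Inl_space_def)

lemma vdist_Inl_space: "vdist Inl_space (Inl x) (Inl y) = dist x y"
  by (simp add: vdist_def Inl_space_simps dist_norm)

lemma normed_space_on_Inl_space: "normed_space_on (Inl_space :: ('y::real_normed_vector + 'u) normed_data)"
  by unfold_locales (auto simp: Inl_space_simps algebra_simps norm_triangle_ineq)

lemma banach_space_on_Inl_space: "banach_space_on (Inl_space :: ('y::banach + 'u) normed_data)"
proof -
  let ?X = "Inl_space :: ('y + 'u) normed_data"
  interpret normed_space_on ?X
    by (rule normed_space_on_Inl_space)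
  interpret Metric_space "points ?X" "vdist ?X"
    by (rule Metric_space_vdist)
  have "mcomplete"
    unfolding mcomplete_def
  proof (intro allI impI)
    fix \<sigma> assume \<sigma>: "MCauchy \<sigma>"
    define s where "s n = projl (\<sigma> n)" for n
    have "range \<sigma> \<subseteq> points ?X"
      using \<sigma> by (simp add: MCauchy_def)
    then have "\<sigma> n \<in> range Inl" for n
      unfolding Inl_space_simps by blast
    then have \<sigma>_eq: "\<sigma> n = Inl (s n)" for n
      by (metis (no_types, lifting) imageE s_def sum.sel(1))
    have "Cauchy s"
      using \<sigma> by (simp add: MCauchy_def Cauchy_def \<sigma>_eq vdist_Inl_space)
    then obtain l where l: "s \<longlonglongrightarrow> l"
      using Cauchy_convergent convergent_def by blast
    have "limitin mtopology \<sigma> (Inl l) sequentially"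
      unfolding limit_metric_sequentially
      using l by (auto simp: Inl_space_simps(1) \<sigma>_eq vdist_Inl_space lim_sequentially)
    then show "\<exists>x. limitin mtopology \<sigma> x sequentially"
      by blast
  qed
  then show ?thesis
    by unfold_locales
qed

lemma continuous_map_projl:
  "continuous_map (norm_topology (Inl_space :: ('y::real_normed_vector + 'u) normed_data)) euclidean projl"
proof -
  let ?X = "Inl_space :: ('y + 'u) normed_data"
  interpret normed_space_on ?X
    by (rule normed_space_on_Inl_space)
  interpret Metric_space "points ?X" "vdist ?X"
    by (rule Metric_space_vdist)
  have "continuous_map mtopology Met_TC.mtopology (projl :: 'y + 'u \<Rightarrow> 'y)"
    unfolding metric_continuous_map[OF Met_TC.Metric_space_axioms]
    by (auto simp: Inl_space_simps(1) vdist_Inl_space)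
  then show ?thesis
    by (simp add: norm_topology_def)
qed

text \<open>A functional composed with \<open>projl\<close> is affine and continuous, so the control
  function 0 works; the map itself is bounded because \<open>C\<close> is.\<close>

lemma DC_bounded_on_projl:
  assumes "bounded C"
  shows "DC_bounded_on (Inl_space :: ('y::real_normed_vector + 'u) normed_data) (Inl ` C) projl"
proof -
  let ?X = "Inl_space :: ('y + 'u) normed_data"
  have cont: "continuous_function_on ?X (Inl ` C) (\<lambda>x. g (projl x))"
    if "continuous_on UNIV g" for g :: "'y \<Rightarrow> 'b::topological_space"
    unfolding continuous_function_on_def
    using continuous_map_compose[OF continuous_map_projl, of euclidean g] that
    by (intro continuous_map_from_subtopology) (auto simp: o_def)
  have "control_function_on ?X (Inl ` C) projl (\<lambda>_. 0)"
    unfolding control_function_on_def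
    using cont[of "\<lambda>_. 0 :: real"]
    by (auto simp: convex_function_on_def Inl_space_simps blinfun.add_right blinfun.scaleR_right
        intro!: cont linear_continuous_on blinfun.bounded_linear_right)
  moreover have "projl ` (Inl ` C :: ('y + 'u) set) = C"
    by force
  moreover have "bounded ((\<lambda>_. 0 :: real) ` (Inl ` C :: ('y + 'u) set))"
    by (auto simp: bounded_iff)
  moreover have "continuous_function_on ?X (Inl ` C) projl"
    using cont[of "\<lambda>x. x"] by simp
  ultimately show ?thesis
    using assms by (auto simp: DC_bounded_on_def DC_map_on_def)
qed

text \<open>A test set \<open>A\<close> for dentability of \<open>D\<close> need not be convex, so
  the map is taken on its convex hull, still bounded and inside \<open>D\<close>, and sliced on
  \<open>A\<close>. The half-space found in the copy is pulled back along
  \<open>Inl\<close>.\<close>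

lemma radon_nikodym_if_projl_dentable:
  fixes D :: "'y::banach set"
  assumes D: "convex D"
    and dent: "\<And>C. \<lbrakk>C \<noteq> {}; C \<subseteq> D; convex C; bounded C\<rbrakk> \<Longrightarrow>
      dentable_on (Inl_space :: ('y + 'u) normed_data) (Inl ` C) projl"
  shows "radon_nikodym_property D"
  unfolding radon_nikodym_property_def dentable_on_def bounded_on_type_space
proof (intro allI impI, elim conjE)
  let ?X = "Inl_space :: ('y + 'u) normed_data"
  fix A and \<epsilon> :: real
  assume A: "A \<noteq> {}" "A \<subseteq> D" "bounded A" and \<epsilon>: "\<epsilon> > 0"
  have dent_hull: "dentable_on ?X (Inl ` (convex hull A)) projl"
    using A D by (intro dent) (auto simp: bounded_convex_hull hull_minimal subset_hull)
  have "bounded_on ?X (Inl ` A)"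
    using A(3) by (auto simp: bounded_on_def Inl_space_simps bounded_iff)
  moreover have "Inl ` A \<subseteq> (Inl ` (convex hull A) :: ('y + 'u) set)"
    by (intro image_mono hull_subset)
  ultimately have "\<exists>H. open_half_space_on ?X H \<and> Inl ` A \<inter> H \<noteq> {} \<and>
      bounded (projl ` (Inl ` A \<inter> H)) \<and> diameter (projl ` (Inl ` A \<inter> H)) < \<epsilon>"
    using A(1) \<epsilon> by (intro dent_hull[unfolded dentable_on_def, rule_format]) simp
  then obtain H where H: "open_half_space_on ?X H" "Inl ` A \<inter> H \<noteq> {}"
    "bounded (projl ` (Inl ` A \<inter> H))" "diameter (projl ` (Inl ` A \<inter> H)) < \<epsilon>"
    by blast
  obtain \<phi> a where \<phi>: "\<phi> \<in> dual_on ?X" and H_eq: "H = {x \<in> range Inl. \<phi> x > a}"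
    using H(1) by (auto simp: open_half_space_on_def Inl_space_simps)
  define L where "L = {y :: 'y. \<phi> (Inl y) > a}"
  have "(\<lambda>y. \<phi> (Inl y)) \<in> dual_on type_space"
    using \<phi> by (simp add: dual_on_def Inl_space_simps type_space_def)
  then have "open_half_space_on type_space L"
    unfolding open_half_space_on_def L_def by (intro bexI exI) (auto simp: type_space_def)
  moreover have "projl ` (Inl ` A \<inter> H) = A \<inter> L"
    by (auto simp: H_eq L_def image_image Int_def intro!: rev_image_eqI)
  moreover have "A \<inter> L \<noteq> {}"
    using H(2) by (auto simp: H_eq L_def)
  ultimately show "\<exists>H. open_half_space_on type_space H \<and> A \<inter> H \<noteq> {} \<and>
      bounded ((\<lambda>y. y) ` (A \<inter> H)) \<and> diameter ((\<lambda>y. y) ` (A \<inter> H)) < \<epsilon>"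
    using H(3,4) by (intro exI[of _ L]) auto
qed

subsection \<open>The equivalence\<close>

theorem proposition4p2:
  fixes D :: "'y::banach set"
  assumes "closed D" and "convex D"
  shows "radon_nikodym_property D \<longleftrightarrow>
    (\<forall>X :: ('y + 'u) normed_data. banach_space_on X \<longrightarrow>
      (\<forall>C. C \<noteq> {} \<and> convex_set_on X C \<longrightarrow>
        (\<forall>F :: 'y + 'u \<Rightarrow> 'y. DC_bounded_on X C F \<and> F ` C \<subseteq> D \<longrightarrow> dentable_on X C F)))"
    (is "_ \<longleftrightarrow> ?dentable")
proof
  assume "radon_nikodym_property D"
  then show ?dentable
    using assms by (auto intro: DC_bounded_imp_dentable banach_space_on.axioms(1))
next
  assume *: ?dentable
  show "radon_nikodym_property D"
  \<comment> \<open>The condition is tested on a single Banach space, the copy of \<open>'y\<close>,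
    with bounded convex subsets of \<open>D\<close>.\<close>
  proof (rule radon_nikodym_if_projl_dentable[OF assms(2)])
    fix C assume C: "C \<noteq> {}" "C \<subseteq> D" "convex C" "bounded C"
    let ?X = "Inl_space :: ('y + 'u) normed_data"
    have "convex_set_on ?X (Inl ` C)"
      using C(3) by (auto simp: convex_set_on_def Inl_space_simps convex_alt)
    moreover have "projl ` (Inl ` C :: ('y + 'u) set) \<subseteq> D"
      using C(2) by auto
    ultimately show "dentable_on ?X (Inl ` C) projl"
      using *[rule_format, OF banach_space_on_Inl_space, of "Inl ` C" projl]
        C(1) DC_bounded_on_projl[OF C(4)] by simp
  qed
qed

end
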